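(* Let $R$ be a commutative ring, $h=(h_n)_{n>0}$ a sequence in $R$, and let $a>b>c>d\ge0$ be integers. Suppose that $h$ satisfies $$E(n,2,1,0):\quad h_{n+2}h_{n-2}h_1^2=h_2^2h_{n+1}h_{n-1}-h_3h_1h_n^2$$ for all integers $n$ with $3\le n\le a+b-2$, and that $h_n$ is not a zero-divisor in $R$ for every integer $1\le n\le a+b-4$. Then $h$ satisfies $E(a,b,c,d)$.
   Context: For a sequence $h=(h_n)_{n>0}$ in a commutative ring and integers $a>b>c>d\ge0$, the elliptic relation $E(a,b,c,d)$ is the identity $$h_{a+b}h_{a-b}h_{c+d}h_{c-d}=h_{a+c}h_{a-c}h_{b+d}h_{b-d}-h_{b+c}h_{b-c}h_{a+d}h_{a-d}.$$ *)

theory Defs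
  imports Main
begin

text \<open>
  A sequence \<open>(h\<^sub>n)\<^sub>n\<^sub>>\<^sub>0\<close> is a function on \<^typ>\<open>nat\<close> whose value at \<open>0\<close> is irrelevant: the relation
  is only used for \<open>a > b > c > d\<close>, so every subtraction below is an exact one with a positive result.
\<close>

definition elliptic_rel :: "(nat \<Rightarrow> 'a::comm_ring) \<Rightarrow> nat \<Rightarrow> nat \<Rightarrow> nat \<Rightarrow> nat \<Rightarrow> bool" where
  "elliptic_rel h a b c d \<longleftrightarrow>
     h (a + b) * h (a - b) * h (c + d) * h (c - d) =
       h (a + c) * h (a - c) * h (b + d) * h (b - d)
     - h (b + c) * h (b - c) * h (a + d) * h (a - d)"

text \<open>
  With this convention \<open>0\<close> is a zero-divisor in every nonzero ring.
\<close>

definition zero_divisor :: "'a::comm_ring \<Rightarrow> bool" where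
  "zero_divisor x \<longleftrightarrow> (\<exists>y. y \<noteq> 0 \<and> x * y = 0)"

text \<open>
  The sort \<open>{comm_ring, comm_monoid_mult}\<close> describes exactly the commutative rings with \<open>1\<close>, the
  zero ring included; \<^class>\<open>comm_ring_1\<close> would in addition require \<open>0 \<noteq> 1\<close>.
\<close>

end

theory Submission
  imports Defs
begin

text \<open>
  Extend \<open>h\<close> to an odd function on the integers and put \<open>[x,y] = h (x+y) * h (x-y)\<close>. Then
  \<open>E(a,b,c,d)\<close> is the Pluecker relation \<open>[a,b][c,d] - [a,c][b,d] + [a,d][b,c] = 0\<close>, which is alternating
  in \<open>a,b,c,d\<close> and makes sense for half-integers as well. If it holds for all \<open>(x,y,r,s)\<close> with
  \<open>x, y \<in> {a,b,c,d}\<close>, then \<open>[r,s]\<close> times each \<open>[x,y]\<close> is a \<open>2\<times>2\<close> minor, so it holds for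
  \<open>(a,b,c,d)\<close> up to the factor \<open>[r,s]\<^sup>2\<close>.

  Assume all relations with index sum \<open>a + b < N\<close>, integral and half-integral. The hypothesis
  \<open>E(N-2,2,1,0)\<close> regroups as the relation for the four consecutive (half-)integers
  \<open>(N+1)/2, (N-1)/2, (N-3)/2, (N-5)/2\<close>. Taking the last two as \<open>r, s\<close> and cancelling
  \<open>[r,s] = h (N-4) * h 1\<close> gives the relation for \<open>((N+1)/2, (N-1)/2, c, d)\<close> with any \<open>c, d\<close>. These
  regroup to \<open>E(a,b,1,0)\<close> and \<open>E(a,b,3/2,1/2)\<close> with \<open>a + b = N\<close>, and taking \<open>r, s\<close> to be \<open>1, 0\<close>
  or \<open>3/2, 1/2\<close> gives all relations with index sum \<open>N\<close>.
\<close>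

locale odd_sequence =
  fixes H :: "int \<Rightarrow> 'a::comm_ring"
  assumes H_minus: "H (- x) = - H x" and H_0 [simp]: "H 0 = 0"
begin

text \<open>
  All indices are doubled, so that half-integers become odd integers; only arguments of equal
  parity are meaningful.
\<close>

definition w :: "int \<Rightarrow> int \<Rightarrow> 'a" where
  "w x y = H ((x + y) div 2) * H ((x - y) div 2)"

definition plucker :: "int \<Rightarrow> int \<Rightarrow> int \<Rightarrow> int \<Rightarrow> 'a" where
  "plucker a b c d = w a b * w c d - w a c * w b d + w a d * w b c"

text \<open>Every pair sum is bounded, instead of ordering the indices, so that the class of
  quadruples is closed under permutation. Doubling turns the bound \<open>N\<close> into
  \<open>2 * N\<close>.\<close>

definition plucker_upto :: "int \<Rightarrow> bool" where
  "plucker_upto N \<longleftrightarrow> (\<forall>a b c d. 0 \<le> a \<and> 0 \<le> b \<and> 0 \<le> c \<and> 0 \<le> d \<and>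
     even (a - b) \<and> even (a - c) \<and> even (a - d) \<and>
     a + b \<le> 2 * N \<and> a + c \<le> 2 * N \<and> a + d \<le> 2 * N \<and> b + c \<le> 2 * N \<and> b + d \<le> 2 * N \<and> c + d \<le> 2 * N
     \<longrightarrow> plucker a b c d = 0)"

lemma plucker_uptoD:
  assumes "plucker_upto N" "0 \<le> a" "0 \<le> b" "0 \<le> c" "0 \<le> d"
    "even (a - b)" "even (a - c)" "even (a - d)"
    "a + b \<le> 2 * N" "a + c \<le> 2 * N" "a + d \<le> 2 * N" "b + c \<le> 2 * N" "b + d \<le> 2 * N" "c + d \<le> 2 * N"
  shows "plucker a b c d = 0"
  using assms unfolding plucker_upto_def by blast

section \<open>Symmetries of the Pluecker expression\<close>

lemma w_eq: "x + y = 2 * p \<Longrightarrow> x - y = 2 * q \<Longrightarrow> w x y = H p * H q"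
  by (simp add: w_def)

lemma w_self [simp]: "w x x = 0"
  by (simp add: w_def)

lemma w_swap:
  assumes "even (x - y)"
  shows "w y x = - w x y"
proof -
  obtain k where k: "x - y = 2 * k" using assms by blast
  have "w x y = H (y + k) * H k" by (rule w_eq) (use k in auto)
  moreover have "w y x = H (y + k) * H (- k)" by (rule w_eq) (use k in auto)
  ultimately show ?thesis by (simp add: H_minus)
qed

lemma plucker_swap:
  assumes "even (a - b)"
  shows "plucker b a c d = - plucker a b c d"
  using w_swap[OF assms] by (simp add: plucker_def algebra_simps)

lemma plucker_eq_0:
  assumes "even (a - b)" "even (a - c)" "even (a - d)"
    and "a = b \<or> a = c \<or> a = d \<or> b = c \<or> b = d \<or> c = d"
  shows "plucker a b c d = 0"
proof -
  have "even (b - c)" "even (b - d)" "even (c - d)" using assms by presburger+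
  then show ?thesis
    using assms(4) w_swap[OF assms(1)] w_swap[OF assms(2)] w_swap[OF assms(3)]
      w_swap[of b c] w_swap[of b d] w_swap[of c d]
    by (auto simp: plucker_def algebra_simps)
qed

lemma w_rs_times:
  assumes "plucker x y r s = 0"
  shows "w r s * w x y = w x r * w y s - w x s * w y r"
  using assms by (simp add: plucker_def algebra_simps)

lemma plucker_of_gauge:
  assumes canc: "\<And>y. w r s * y = 0 \<Longrightarrow> y = 0"
    and ab: "plucker a b r s = 0" and ac: "plucker a c r s = 0" and ad: "plucker a d r s = 0"
    and bc: "plucker b c r s = 0" and bd: "plucker b d r s = 0" and cd: "plucker c d r s = 0"
  shows "plucker a b c d = 0"
proof -
  have "w r s * (w r s * plucker a b c d) =
      (w r s * w a b) * (w r s * w c d) - (w r s * w a c) * (w r s * w b d)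
      + (w r s * w a d) * (w r s * w b c)"
    by (simp add: plucker_def algebra_simps)
  \<comment> \<open>This is the Pluecker identity for the 2x2 minors of the 2x4 matrix with columns
    \<open>(w x r, w x s)\<close>, where x runs through a, b, c, d.\<close>
  also have "\<dots> = 0"
    unfolding w_rs_times[OF ab] w_rs_times[OF ac] w_rs_times[OF ad] w_rs_times[OF bc]
      w_rs_times[OF bd] w_rs_times[OF cd]
    by (simp add: algebra_simps)
  finally show ?thesis by (blast dest: canc)
qed

text \<open>Let t be half the sum of the four indices on the right. Replacing each index x by t - x
  turns each pair sum into that of the complementary pair and only changes the sign of differences,
  so each of the three products keeps its factors. The last index is negated as well, which merely
  swaps the two factors of \<open>w\<close>.\<close>

lemma plucker_regroup_even:
  "plucker (n + m + 1) (n + m - 1) (n - m + 1) (n - m - 1) = plucker (2 * n) (2 * m) 2 0"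
proof -
  have "w (n + m + 1) (n + m - 1) = H (n + m) * H 1" "w (n - m + 1) (n - m - 1) = H (n - m) * H 1"
    "w (n + m + 1) (n - m + 1) = H (n + 1) * H m" "w (n + m - 1) (n - m - 1) = H (n - 1) * H m"
    "w (n + m + 1) (n - m - 1) = H n * H (m + 1)" "w (n + m - 1) (n - m + 1) = H n * H (m - 1)"
    "w (2 * n) (2 * m) = H (n + m) * H (n - m)" "w 2 0 = H 1 * H 1"
    "w (2 * n) 2 = H (n + 1) * H (n - 1)" "w (2 * m) 0 = H m * H m"
    "w (2 * n) 0 = H n * H n" "w (2 * m) 2 = H (m + 1) * H (m - 1)"
    by (rule w_eq; simp)+
  then show ?thesis by (simp add: plucker_def ac_simps)
qed

lemma plucker_regroup_odd:
  "plucker (n + m + 2) (n + m) (n - m + 2) (n - m - 2) = plucker (2 * n + 1) (2 * m + 1) 3 1"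
proof -
  have "w (n + m + 2) (n + m) = H (n + m + 1) * H 1" "w (n - m + 2) (n - m - 2) = H (n - m) * H 2"
    "w (n + m + 2) (n - m + 2) = H (n + 2) * H m" "w (n + m) (n - m - 2) = H (n - 1) * H (m + 1)"
    "w (n + m + 2) (n - m - 2) = H n * H (m + 2)" "w (n + m) (n - m + 2) = H (n + 1) * H (m - 1)"
    "w (2 * n + 1) (2 * m + 1) = H (n + m + 1) * H (n - m)" "w 3 1 = H 2 * H 1"
    "w (2 * n + 1) 3 = H (n + 2) * H (n - 1)" "w (2 * m + 1) 1 = H (m + 1) * H m"
    "w (2 * n + 1) 1 = H (n + 1) * H n" "w (2 * m + 1) 3 = H (m + 2) * H (m - 1)"
    by (rule w_eq; simp)+
  then show ?thesis by (simp add: plucker_def ac_simps)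
qed

section \<open>Quadruples too small to be distinct\<close>

lemma not_distinct_if_sums_le_4:
  fixes a b c d :: int
  assumes "0 \<le> a" "0 \<le> b" "0 \<le> c" "0 \<le> d"
    "a + b \<le> 4" "a + c \<le> 4" "a + d \<le> 4" "b + c \<le> 4" "b + d \<le> 4" "c + d \<le> 4"
  shows "a = b \<or> a = c \<or> a = d \<or> b = c \<or> b = d \<or> c = d"
  using assms by (smt (verit))

text \<open>Here \<open>e\<close> is the common parity. Removing it and halving leaves pair sums of
  at most 4, which forces a repetition. Odd indices thus get the larger bound 10, which settles them
  for \<open>N = 5\<close> too.\<close>

lemma plucker_eq_0_if_small:
  assumes "e = 0 \<or> e = 1" and "even (a - e)" "even (b - e)" "even (c - e)" "even (d - e)"
    and "0 \<le> a" "0 \<le> b" "0 \<le> c" "0 \<le> d"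
    and "a + b \<le> 8 + 2 * e" "a + c \<le> 8 + 2 * e" "a + d \<le> 8 + 2 * e"
      "b + c \<le> 8 + 2 * e" "b + d \<le> 8 + 2 * e" "c + d \<le> 8 + 2 * e"
  shows "plucker a b c d = 0"
proof -
  obtain a' where a: "a - e = 2 * a'" using assms(2) by (rule dvdE)
  obtain b' where b: "b - e = 2 * b'" using assms(3) by (rule dvdE)
  obtain c' where c: "c - e = 2 * c'" using assms(4) by (rule dvdE)
  obtain d' where d: "d - e = 2 * d'" using assms(5) by (rule dvdE)
  have "0 \<le> a'" "0 \<le> b'" "0 \<le> c'" "0 \<le> d'"
    using assms(1,6-9) a b c d by linarith+
  then have "a' = b' \<or> a' = c' \<or> a' = d' \<or> b' = c' \<or> b' = d' \<or> c' = d'"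
    by (rule not_distinct_if_sums_le_4; use assms(10-) a b c d in linarith)
  then have "a = b \<or> a = c \<or> a = d \<or> b = c \<or> b = d \<or> c = d"
    using a b c d by auto
  moreover have "a - b = 2 * (a' - b')" "a - c = 2 * (a' - c')" "a - d = 2 * (a' - d')"
    using a b c d by auto
  ultimately show ?thesis by (intro plucker_eq_0) simp_all
qed

section \<open>Induction on the index sum\<close>

lemma plucker_consecutive:
  assumes N: "5 \<le> N" and IH: "plucker_upto (N - 1)"
    and rec: "plucker (2 * (N - 2)) 4 2 0 = 0"
    and canc: "\<And>j y. 1 \<le> j \<Longrightarrow> j \<le> N - 4 \<Longrightarrow> H j * y = 0 \<Longrightarrow> y = 0"
    and c: "0 \<le> c" "c \<le> N - 3" "even (N + 1 - c)" and d: "0 \<le> d" "d \<le> N - 3" "even (N + 1 - d)"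
  shows "plucker (N + 1) (N - 1) c d = 0"
proof -
  have even: "even (c - d)" using c(3) d(3) by presburger
  have canc_w: "y = 0" if "w (N - 3) (N - 5) * y = 0" for y
  proof -
    have "w (N - 3) (N - 5) = H (N - 4) * H 1" by (rule w_eq) auto
    then show ?thesis
      using that canc[of "N - 4" "H 1 * y"] canc[of 1 y] N by (simp add: mult.assoc)
  qed
  have base: "plucker (N + 1) (N - 1) (N - 3) (N - 5) = 0"
    using plucker_regroup_even[of "N - 2" 2] rec by (simp add: algebra_simps)
  show ?thesis
    \<comment> \<open>In the five relations other than \<open>base\<close>, pair sums are at most (N
      + 1) + (N - 3) = 2 * (N - 1), so \<open>IH\<close> covers them.\<close>
    by (rule plucker_of_gauge[OF canc_w base]; (rule plucker_uptoD[OF IH])?) (use N c d even in auto)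
qed

lemma plucker_gauge:
  assumes N: "5 \<le> N" and IH: "plucker_upto (N - 1)"
    and rec: "plucker (2 * (N - 2)) 4 2 0 = 0"
    and canc: "\<And>j y. 1 \<le> j \<Longrightarrow> j \<le> N - 4 \<Longrightarrow> H j * y = 0 \<Longrightarrow> y = 0"
    and rs: "r = 2 \<and> s = 0 \<or> r = 3 \<and> s = 1"
    and xy: "0 \<le> y" "y \<le> x" "x + y \<le> 2 * N" "even (x - r)" "even (y - r)"
  shows "plucker x y r s = 0"
proof -
  have par: "even (x - y)" "even (x - r)" "even (x - s)" using rs xy by presburger+
  consider "x = y \<or> y = r \<or> y = s" | "x + y \<le> 2 * (N - 1)" "r < y" "y < x"
    | "x + y = 2 * N" "r < y" "y < x"
  proof -
    \<comment> \<open>Among the nonnegative integers of its parity, \<open>s\<close> is the only one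
      below \<open>r\<close>.\<close>
    have "y = s \<or> y = r \<or> r < y" using rs xy by presburger
    moreover have "x + y = 2 * N \<or> x + y \<le> 2 * (N - 1)" using xy by presburger
    ultimately show thesis using that xy(2) by linarith
  qed
  then show ?thesis
  proof cases
    case 1
    then show ?thesis using plucker_eq_0[OF par] by blast
  next
    case 2
    then show ?thesis
      by (intro plucker_uptoD[OF IH]) (use N rs xy par in auto)
  next
    case 3
    note consecutive = plucker_consecutive[OF N IH rec canc]
    show ?thesis using rs
    proof
      assume "r = 2 \<and> s = 0"
      then have r: "r = 2" "s = 0" by auto
      obtain n where n: "x = 2 * n" using xy(4) r by auto
      obtain m where m: "y = 2 * m" using xy(5) r by auto
      have nm: "N = n + m" "2 \<le> m" "m < n" using 3 n m r by auto
      have "plucker (N + 1) (N - 1) (n - m + 1) (n - m - 1) = 0"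
        by (rule consecutive) (use nm in auto)
      then show ?thesis using plucker_regroup_even[of n m] n m r nm(1) by simp
    next
      assume "r = 3 \<and> s = 1"
      then have r: "r = 3" "s = 1" by auto
      have "odd x" "odd y" using xy(4,5) r by auto
      then obtain n m where n: "x = 2 * n + 1" and m: "y = 2 * m + 1" by (auto elim!: oddE)
      have nm: "N = n + m + 1" "2 \<le> m" "m < n" using 3 n m r by auto
      show ?thesis
      \<comment> \<open>If \<open>n = m + 1\<close>, regrouping would produce the negative index -1,
        but \<open>x\<close> and \<open>y\<close> already are \<open>N + 1\<close> and
        \<open>N - 1\<close>.\<close>
      proof (cases "n = m + 1")
        case True
        have "plucker (N + 1) (N - 1) 3 1 = 0"
          by (rule consecutive) (use nm True in auto)
        then show ?thesis using n m r nm(1) True by (simp add: algebra_simps)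
      next
        case False
        have "plucker (N + 1) (N - 1) (n - m + 2) (n - m - 2) = 0"
          by (rule consecutive) (use nm False in auto)
        then show ?thesis using plucker_regroup_odd[of n m] n m r nm(1) by (simp add: algebra_simps)
      qed
    qed
  qed
qed

lemma plucker_upto_4: "plucker_upto 4"
  unfolding plucker_upto_def
proof (intro allI impI, elim conjE)
  fix a b c d :: int
  assume nonneg: "0 \<le> a" "0 \<le> b" "0 \<le> c" "0 \<le> d"
    and even: "even (a - b)" "even (a - c)" "even (a - d)"
    and sums: "a + b \<le> 2 * 4" "a + c \<le> 2 * 4" "a + d \<le> 2 * 4" "b + c \<le> 2 * 4" "b + d \<le> 2 * 4" "c + d \<le> 2 * 4"
  show "plucker a b c d = 0"
  proof (cases "even a")
    case True
    then have "even b" "even c" "even d" using even by auto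
    with True show ?thesis
      by (intro plucker_eq_0_if_small[of 0]) (use nonneg sums in auto)
  next
    case False
    then have odd: "odd a" "odd b" "odd c" "odd d" using even by auto
    show ?thesis
      by (intro plucker_eq_0_if_small[of 1]) (use nonneg odd sums in auto)
  qed
qed

lemma plucker_upto_step:
  assumes N: "5 \<le> N" and IH: "plucker_upto (N - 1)"
    and rec: "plucker (2 * (N - 2)) 4 2 0 = 0"
    and canc: "\<And>j y. 1 \<le> j \<Longrightarrow> j \<le> N - 4 \<Longrightarrow> H j * y = 0 \<Longrightarrow> y = 0"
  shows "plucker_upto N"
  unfolding plucker_upto_def
proof (intro allI impI, elim conjE)
  fix a b c d :: int
  assume nonneg: "0 \<le> a" "0 \<le> b" "0 \<le> c" "0 \<le> d"
    and even: "even (a - b)" "even (a - c)" "even (a - d)"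
    and sums: "a + b \<le> 2 * N" "a + c \<le> 2 * N" "a + d \<le> 2 * N" "b + c \<le> 2 * N" "b + d \<le> 2 * N" "c + d \<le> 2 * N"
  have gauge: "plucker x y r s = 0"
    if "r = 2 \<and> s = 0 \<or> r = 3 \<and> s = 1" "0 \<le> x" "0 \<le> y" "x + y \<le> 2 * N" "even (x - r)" "even (y - r)"
    for x y r s
  proof (cases "y \<le> x")
    case True
    show ?thesis
      by (rule plucker_gauge[OF N IH rec]) (fact canc that True)+
  next
    case False
    have "plucker y x r s = 0"
      by (rule plucker_gauge[OF N IH rec]) (fact canc | use False that in simp)+
    moreover have "even (y - x)" using that(5,6) by presburger
    ultimately show ?thesis using plucker_swap[of y x r s] by simp
  qed
  show "plucker a b c d = 0"
  proof (cases "even a")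
    case True
    have canc_w: "y = 0" if "w 2 0 * y = 0" for y
    proof -
      have "w 2 0 = H 1 * H 1" by (rule w_eq) auto
      then show ?thesis using that canc[of 1 "H 1 * y"] canc[of 1 y] N by (simp add: mult.assoc)
    qed
    show ?thesis
      by (rule plucker_of_gauge[where r = 2 and s = 0]; (erule canc_w | rule gauge))
        (use nonneg even sums True in auto)
  next
    case False
    then have odd: "odd a" "odd b" "odd c" "odd d" using even by auto
    show ?thesis
    \<comment> \<open>The factor \<open>H 2\<close> of \<open>w 3 1\<close> can be cancelled only if
      2 \<le> N - 4, so \<open>N = 5\<close> is treated apart.\<close>
    proof (cases "N = 5")
      case True
      then show ?thesis
        by (intro plucker_eq_0_if_small[of 1]) (use nonneg odd sums in auto)
    next
      case N5: False
      have canc_w: "y = 0" if "w 3 1 * y = 0" for y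
      proof -
        have "w 3 1 = H 2 * H 1" by (rule w_eq) auto
        then show ?thesis using that canc[of 2 "H 1 * y"] canc[of 1 y] N N5 by (simp add: mult.assoc)
      qed
      show ?thesis
        by (rule plucker_of_gauge[where r = 3 and s = 1]; (erule canc_w | rule gauge))
          (use nonneg even sums False in auto)
    qed
  qed
qed

end

section \<open>Application to the given sequence\<close>

definition odd_ext :: "(nat \<Rightarrow> 'a::comm_ring) \<Rightarrow> int \<Rightarrow> 'a" where
  "odd_ext h i = (if i > 0 then h (nat i) else if i < 0 then - h (nat (- i)) else 0)"

lemma odd_sequence_odd_ext: "odd_sequence (odd_ext h)"
  by unfold_locales (auto simp: odd_ext_def)

lemma elliptic_rel_iff_plucker:
  assumes "b < a" "c < b" "d < c"
  shows "elliptic_rel h a b c d \<longleftrightarrow>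
    odd_sequence.plucker (odd_ext h) (2 * int a) (2 * int b) (2 * int c) (2 * int d) = 0"
proof -
  interpret odd_sequence "odd_ext h" by (rule odd_sequence_odd_ext)
  have w: "w (2 * int x) (2 * int y) = h (x + y) * h (x - y)" if "y < x" for x y
  proof -
    have "w (2 * int x) (2 * int y) = odd_ext h (int (x + y)) * odd_ext h (int (x - y))"
      by (rule w_eq) (use that in auto)
    then show ?thesis using that by (simp add: odd_ext_def flip: of_nat_add of_nat_diff)
  qed
  have "plucker (2 * int a) (2 * int b) (2 * int c) (2 * int d) =
      (h (a + b) * h (a - b)) * (h (c + d) * h (c - d)) - (h (a + c) * h (a - c)) * (h (b + d) * h (b - d))
      + (h (a + d) * h (a - d)) * (h (b + c) * h (b - c))"
    using assms w[of b a] w[of d c] w[of c a] w[of d b] w[of d a] w[of c b]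
    by (simp add: plucker_def)
  then show ?thesis
    unfolding elliptic_rel_def by (simp only:) (simp add: algebra_simps)
qed

theorem theorem2p4:
  fixes h :: "nat \<Rightarrow> 'a::{comm_ring, comm_monoid_mult}"
    and a b c d :: nat
  assumes "a > b" and "b > c" and "c > d"
    and "\<And>n. 3 \<le> n \<Longrightarrow> n \<le> a + b - 2 \<Longrightarrow> elliptic_rel h n 2 1 0"
    and "\<And>n. 1 \<le> n \<Longrightarrow> n \<le> a + b - 4 \<Longrightarrow> \<not> zero_divisor (h n)"
  shows "elliptic_rel h a b c d"
proof -
  interpret odd_sequence "odd_ext h" by (rule odd_sequence_odd_ext)
  have "plucker_upto (int N)" if "4 \<le> N" "N \<le> a + b" for N
    using that
  proof (induction N rule: dec_induct)
    case base
    then show ?case using plucker_upto_4 by simp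
  next
    case (step N)
    \<comment> \<open>Reaching \<open>Suc N\<close> takes the recurrence at \<open>Suc N - 2\<close>
      and cancellation up to \<open>Suc N - 4\<close>. For \<open>Suc N = a + b\<close> these are
      exactly the bounds in the hypotheses.\<close>
    have "elliptic_rel h (N - 1) 2 1 0" using step assms(4) by simp
    then have rec: "plucker (2 * (int (Suc N) - 2)) 4 2 0 = 0"
      using elliptic_rel_iff_plucker[of 2 "N - 1" 1 0 h] step by simp
    have canc: "y = 0" if "1 \<le> j" "j \<le> int (Suc N) - 4" "odd_ext h j * y = 0" for j y
    proof -
      have "\<not> zero_divisor (h (nat j))"
        using that step by (intro assms(5)) auto
      then show ?thesis using that by (auto simp: zero_divisor_def odd_ext_def)
    qed
    show ?case
      by (rule plucker_upto_step[OF _ _ rec canc]) (use step in auto)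
  qed
  from this[of "a + b"] have "plucker_upto (int (a + b))" using assms(1-3) by simp
  then have "plucker (2 * int a) (2 * int b) (2 * int c) (2 * int d) = 0"
    by (rule plucker_uptoD) (use assms(1-3) in auto)
  then show ?thesis using elliptic_rel_iff_plucker assms(1-3) by blast
qed

end
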